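(* Let $m,n\ge2$ be integers. The partition of the power set $2^{V_{m,n}}$ into orbits under the action of $G_{m,n}$ has property C with respect to $T_{m,n}$: if $\mathcal{O}_1,\mathcal{O}_2\in 2^{V_{m,n}}/G_{m,n}$ are orbits and $U_1,U_2\in\mathcal{O}_1$, then $$\sum_{V\in\mathcal{O}_2}T_{m,n}(U_1,V)=\sum_{V\in\mathcal{O}_2}T_{m,n}(U_2,V).$$
   Context: For integers $m,n\ge2$, let $V_{m,n}:=\mathbb{Z}/m\mathbb{Z}\times\mathbb{Z}/n\mathbb{Z}$ with componentwise addition, and $D:=\{(0,0),(1,0),(0,1)\}\subset V_{m,n}$. The matrix $A_{m,n}$, with rows and columns indexed by $V_{m,n}$, has entries $A_{m,n}(\mathbf{u},\mathbf{v})=1$ if $\mathbf{v}-\mathbf{u}\in D$ and $0$ otherwise. For $R,C\subseteq V_{m,n}$, $A_{m,n}[R,C]$ is the submatrix with row set $R$ and column set $C$. The matrix $T_{m,n}$, with rows and columns indexed by the power set $2^{V_{m,n}}$, has entries $$T_{m,n}(U,V):=\begin{cases}\operatorname{per}A_{m,n}[U,V_{m,n}\setminus V] & \text{if }|U|+|V|=mn,\\ 0&\text{otherwise,}\end{cases}$$ where for $|R|=|C|$, $\operatorname{per}A_{m,n}[R,C]=\sum_{\sigma:R\to C\text{ bijection}}\prod_{\mathbf{u}\in R}A_{m,n}(\mathbf{u},\sigma(\mathbf{u}))$ is the permanent, and the permanent of the empty matrix is $1$. Let $K_{m,n}:=\{\varphi\in\operatorname{Aut}(V_{m,n}) : \text{there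 exists }\mathbf{t}_\varphi\in V_{m,n}\text{ such that }\varphi(D)=\mathbf{t}_\varphi+D\}$, where $\operatorname{Aut}(V_{m,n})$ is the group of group automorphisms, and let $G_{m,n}:=V_{m,n}\rtimes K_{m,n}$, with $K_{m,n}$ acting on $V_{m,n}$ in the natural way. $G_{m,n}$ acts on $V_{m,n}$ by $(\mathbf{u},\varphi)\cdot\mathbf{v}:=\mathbf{u}+\varphi(\mathbf{v})$, and hence on subsets of $V_{m,n}$ elementwise; $2^{V_{m,n}}/G_{m,n}$ denotes the set of orbits of subsets. *)

theory Defs
  imports "HOL-Algebra.Elementary_Groups" "HOL-Algebra.Group_Action"
begin

section \<open>Permanents\<close>

text \<open>A matrix is a function of its row and column index. The bijections from \<open>R\<close> to \<open>C\<close>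
  are taken extensional, so that each of them is counted exactly once; if \<open>R\<close> and \<open>C\<close> are both
  empty, there is exactly one of them and the permanent is 1.\<close>

definition per_submatrix :: "('i \<Rightarrow> 'j \<Rightarrow> 'a::comm_semiring_1) \<Rightarrow> 'i set \<Rightarrow> 'j set \<Rightarrow> 'a" where
  "per_submatrix A R C = (\<Sum>\<sigma> | \<sigma> \<in> R \<rightarrow>\<^sub>E C \<and> bij_betw \<sigma> R C. \<Prod>u\<in>R. A u (\<sigma> u))"

lemma per_submatrix_empty: "per_submatrix A {} {} = 1"
proof -
  have eq: "{\<sigma>. \<sigma> \<in> {} \<rightarrow>\<^sub>E {} \<and> bij_betw \<sigma> {} {}} = {\<lambda>_. undefined}"
    by (auto simp: bij_betw_def)
  show ?thesis
    unfolding per_submatrix_def eq by simp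
qed


section \<open>Semidirect products\<close>

definition semidirect_prod ::
  "('a, 'c) monoid_scheme \<Rightarrow> ('b, 'd) monoid_scheme \<Rightarrow> ('b \<Rightarrow> 'a \<Rightarrow> 'a) \<Rightarrow> ('a \<times> 'b) monoid" where
  "semidirect_prod N H \<theta> =
     \<lparr>carrier = carrier N \<times> carrier H,
      monoid.mult = (\<lambda>(u, g) (v, h). (u \<otimes>\<^bsub>N\<^esub> \<theta> g v, g \<otimes>\<^bsub>H\<^esub> h)),
      one = (\<one>\<^bsub>N\<^esub>, \<one>\<^bsub>H\<^esub>)\<rparr>"

lemma autoD:
  assumes "\<phi> \<in> auto N"
  shows "\<phi> \<in> hom N N" "bij_betw \<phi> (carrier N) (carrier N)" "\<phi> \<in> extensional (carrier N)"
    "x \<in> carrier N \<Longrightarrow> \<phi> x \<in> carrier N"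
    "\<lbrakk>x \<in> carrier N; y \<in> carrier N\<rbrakk> \<Longrightarrow> \<phi> (x \<otimes>\<^bsub>N\<^esub> y) = \<phi> x \<otimes>\<^bsub>N\<^esub> \<phi> y"
  using assms by (auto simp: auto_def Bij_def hom_def)

lemma AutoGroup_simps:
  "carrier (AutoGroup N) = auto N"
  "\<one>\<^bsub>AutoGroup N\<^esub> = (\<lambda>x\<in>carrier N. x)"
  "\<lbrakk>\<phi> \<in> auto N; \<psi> \<in> auto N\<rbrakk> \<Longrightarrow> \<phi> \<otimes>\<^bsub>AutoGroup N\<^esub> \<psi> = compose (carrier N) \<phi> \<psi>"
  by (auto simp: AutoGroup_def BijGroup_def auto_def)

lemma group_semidirect_prod:
  assumes "group N" "group H" "\<theta> \<in> hom H (AutoGroup N)"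
  shows "group (semidirect_prod N H \<theta>)"
proof -
  interpret N: group N by fact
  interpret H: group H by fact
  interpret A: group "AutoGroup N" by (rule N.AutoGroup)
  interpret hm: group_hom H "AutoGroup N" \<theta>
    using assms(3) by unfold_locales
  have aut: "\<theta> g \<in> auto N" if "g \<in> carrier H" for g
    using hm.hom_closed[OF that] by (simp add: AutoGroup_simps)
  have mult: "\<theta> (g \<otimes>\<^bsub>H\<^esub> h) x = \<theta> g (\<theta> h x)"
    if "g \<in> carrier H" "h \<in> carrier H" "x \<in> carrier N" for g h x
    using that by (simp add: AutoGroup_simps aut compose_eq)
  have one: "\<theta> \<one>\<^bsub>H\<^esub> x = x" if "x \<in> carrier N" for x
    using that by (simp add: AutoGroup_simps)
  note cl = autoD(4)[OF aut] and dist = autoD(5)[OF aut]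
  show ?thesis
  proof (rule groupI)
    fix x assume "x \<in> carrier (semidirect_prod N H \<theta>)"
    then obtain u g where x: "x = (u, g)" "u \<in> carrier N" "g \<in> carrier H"
      by (auto simp: semidirect_prod_def)
    define g' where "g' = inv\<^bsub>H\<^esub> g"
    have g': "g' \<in> carrier H" "g' \<otimes>\<^bsub>H\<^esub> g = \<one>\<^bsub>H\<^esub>"
      using x by (auto simp: g'_def)
    define u' where "u' = inv\<^bsub>N\<^esub> (\<theta> g' u)"
    have u': "u' \<in> carrier N" "u' \<otimes>\<^bsub>N\<^esub> \<theta> g' u = \<one>\<^bsub>N\<^esub>"
      using x g' cl by (auto simp: u'_def)
    show "\<exists>y\<in>carrier (semidirect_prod N H \<theta>).
        y \<otimes>\<^bsub>semidirect_prod N H \<theta>\<^esub> x = \<one>\<^bsub>semidirect_prod N H \<theta>\<^esub>"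
      by (rule bexI[of _ "(u', g')"]) (use x g' u' in \<open>auto simp: semidirect_prod_def\<close>)
  qed (auto simp: semidirect_prod_def cl dist mult one N.m_assoc H.m_assoc
      simp del: hm.hom_mult hm.hom_one)
qed


section \<open>The group \<open>V\<close> and the matrices \<open>A\<close> and \<open>T\<close>\<close>

text \<open>The residues modulo \<open>m\<close> are represented by \<open>0, \<dots>, m - 1\<close>; the group operation, written
  multiplicatively in the library, is addition modulo \<open>m\<close> and \<open>n\<close>.\<close>

definition Vgrp :: "nat \<Rightarrow> nat \<Rightarrow> (int \<times> int) monoid" where
  "Vgrp m n = integer_mod_group m \<times>\<times> integer_mod_group n"

definition Dset :: "(int \<times> int) set" where
  "Dset = {(0, 0), (1, 0), (0, 1)}"

definition Amat :: "nat \<Rightarrow> nat \<Rightarrow> int \<times> int \<Rightarrow> int \<times> int \<Rightarrow> int" where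
  "Amat m n u v = (if v \<otimes>\<^bsub>Vgrp m n\<^esub> inv\<^bsub>Vgrp m n\<^esub> u \<in> Dset then 1 else 0)"

definition Tmat :: "nat \<Rightarrow> nat \<Rightarrow> (int \<times> int) set \<Rightarrow> (int \<times> int) set \<Rightarrow> int" where
  "Tmat m n U V =
     (if card U + card V = m * n
      then per_submatrix (Amat m n) U (carrier (Vgrp m n) - V) else 0)"


section \<open>The group \<open>G\<close> and its action on subsets\<close>

definition Kset :: "nat \<Rightarrow> nat \<Rightarrow> (int \<times> int \<Rightarrow> int \<times> int) set" where
  "Kset m n = {\<phi> \<in> auto (Vgrp m n). \<exists>t\<in>carrier (Vgrp m n). \<phi> ` Dset = t <#\<^bsub>Vgrp m n\<^esub> Dset}"

definition Kgrp :: "nat \<Rightarrow> nat \<Rightarrow> (int \<times> int \<Rightarrow> int \<times> int) monoid" where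
  "Kgrp m n = AutoGroup (Vgrp m n) \<lparr>carrier := Kset m n\<rparr>"

definition Ggrp :: "nat \<Rightarrow> nat \<Rightarrow> ((int \<times> int) \<times> (int \<times> int \<Rightarrow> int \<times> int)) monoid" where
  "Ggrp m n = semidirect_prod (Vgrp m n) (Kgrp m n) (\<lambda>\<phi>. \<phi>)"

definition point_act ::
  "nat \<Rightarrow> nat \<Rightarrow> (int \<times> int) \<times> (int \<times> int \<Rightarrow> int \<times> int) \<Rightarrow> int \<times> int \<Rightarrow> int \<times> int" where
  "point_act m n = (\<lambda>(u, \<phi>). \<lambda>v\<in>carrier (Vgrp m n). u \<otimes>\<^bsub>Vgrp m n\<^esub> \<phi> v)"

definition subset_act ::
  "nat \<Rightarrow> nat \<Rightarrow> (int \<times> int) \<times> (int \<times> int \<Rightarrow> int \<times> int) \<Rightarrow> (int \<times> int) set \<Rightarrow> (int \<times> int) set" where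
  "subset_act m n g = (\<lambda>S\<in>Pow (carrier (Vgrp m n)). point_act m n g ` S)"

definition subset_orbits :: "nat \<Rightarrow> nat \<Rightarrow> (int \<times> int) set set set" where
  "subset_orbits m n = orbits (Ggrp m n) (Pow (carrier (Vgrp m n))) (subset_act m n)"

definition property_C :: "('i \<Rightarrow> 'i \<Rightarrow> 'a::comm_monoid_add) \<Rightarrow> 'i set set \<Rightarrow> bool" where
  "property_C T P \<longleftrightarrow>
     (\<forall>O1\<in>P. \<forall>O2\<in>P. \<forall>U1\<in>O1. \<forall>U2\<in>O1. (\<Sum>V\<in>O2. T U1 V) = (\<Sum>V\<in>O2. T U2 V))"


subsection \<open>Well-definedness of the group and of the partition into orbits\<close>

lemma group_Vgrp: "group (Vgrp m n)"
  by (simp add: Vgrp_def DirProd_group)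

lemma carrier_Vgrp:
  "\<lbrakk>m > 0; n > 0\<rbrakk> \<Longrightarrow> carrier (Vgrp m n) = {0..<int m} \<times> {0..<int n}"
  by (simp add: Vgrp_def carrier_integer_mod_group)

lemma Dset_subset: "\<lbrakk>m \<ge> 2; n \<ge> 2\<rbrakk> \<Longrightarrow> Dset \<subseteq> carrier (Vgrp m n)"
  by (auto simp: carrier_Vgrp Dset_def)

lemma subgroup_Kset:
  assumes "m \<ge> 2" "n \<ge> 2"
  shows "subgroup (Kset m n) (AutoGroup (Vgrp m n))"
proof -
  interpret V: group "Vgrp m n" by (rule group_Vgrp)
  interpret A: group "AutoGroup (Vgrp m n)" by (rule V.AutoGroup)
  note D = Dset_subset[OF assms]
  have coset: "\<phi> ` (t <#\<^bsub>Vgrp m n\<^esub> S) = \<phi> t <#\<^bsub>Vgrp m n\<^esub> (\<phi> ` S)"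
    if "\<phi> \<in> auto (Vgrp m n)" "t \<in> carrier (Vgrp m n)" "S \<subseteq> carrier (Vgrp m n)" for \<phi> t S
  proof -
    have l: "x <#\<^bsub>Vgrp m n\<^esub> X = (\<otimes>\<^bsub>Vgrp m n\<^esub>) x ` X" for x X
      by (auto simp: l_coset_def)
    show ?thesis
      unfolding l image_image using that by (intro image_cong refl autoD(5)) auto
  qed
  have img: "\<phi> ` S \<subseteq> carrier (Vgrp m n)"
    if "\<phi> \<in> auto (Vgrp m n)" "S \<subseteq> carrier (Vgrp m n)" for \<phi> S
    using that autoD(4)[OF that(1)] by blast
  have compose_img: "compose (carrier (Vgrp m n)) \<phi> \<psi> ` Dset = \<phi> ` (\<psi> ` Dset)" for \<phi> \<psi>
    unfolding image_image using D by (intro image_cong refl) (auto intro!: compose_eq)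
  show ?thesis
  proof (rule A.subgroupI)
    show "Kset m n \<subseteq> carrier (AutoGroup (Vgrp m n))"
      by (auto simp: Kset_def AutoGroup_simps)
    have "(\<lambda>x\<in>carrier (Vgrp m n). x) \<in> Kset m n"
      using D V.id_in_auto V.lcos_mult_one[OF D] V.one_closed
      by (auto simp: Kset_def subset_iff intro!: bexI[of _ "\<one>\<^bsub>Vgrp m n\<^esub>"])
    then show "Kset m n \<noteq> {}" by blast
  next
    fix \<phi> \<psi> assume "\<phi> \<in> Kset m n" "\<psi> \<in> Kset m n"
    then obtain s t where
      \<phi>: "\<phi> \<in> auto (Vgrp m n)" "s \<in> carrier (Vgrp m n)" "\<phi> ` Dset = s <#\<^bsub>Vgrp m n\<^esub> Dset" and
      \<psi>: "\<psi> \<in> auto (Vgrp m n)" "t \<in> carrier (Vgrp m n)" "\<psi> ` Dset = t <#\<^bsub>Vgrp m n\<^esub> Dset"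
      by (auto simp: Kset_def)
    have "\<phi> ` (\<psi> ` Dset) = (\<phi> t \<otimes>\<^bsub>Vgrp m n\<^esub> s) <#\<^bsub>Vgrp m n\<^esub> Dset"
      using \<phi> \<psi> D by (simp add: coset V.lcos_m_assoc autoD(4))
    moreover have "\<phi> \<otimes>\<^bsub>AutoGroup (Vgrp m n)\<^esub> \<psi> \<in> auto (Vgrp m n)"
      using A.m_closed[of \<phi> \<psi>] \<phi> \<psi> by (simp add: AutoGroup_simps(1))
    ultimately show "\<phi> \<otimes>\<^bsub>AutoGroup (Vgrp m n)\<^esub> \<psi> \<in> Kset m n"
      using \<phi> \<psi> by (auto simp: Kset_def AutoGroup_simps compose_img autoD(4)
          intro!: bexI[of _ "\<phi> t \<otimes>\<^bsub>Vgrp m n\<^esub> s"])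
  next
    fix \<phi> assume "\<phi> \<in> Kset m n"
    then obtain s where
      \<phi>: "\<phi> \<in> auto (Vgrp m n)" "s \<in> carrier (Vgrp m n)" "\<phi> ` Dset = s <#\<^bsub>Vgrp m n\<^esub> Dset"
      by (auto simp: Kset_def)
    define \<psi> where "\<psi> = inv\<^bsub>AutoGroup (Vgrp m n)\<^esub> \<phi>"
    have \<psi>: "\<psi> \<in> auto (Vgrp m n)"
      using A.inv_closed[of \<phi>] \<phi> by (simp add: \<psi>_def AutoGroup_simps(1))
    have "compose (carrier (Vgrp m n)) \<psi> \<phi> = (\<lambda>x\<in>carrier (Vgrp m n). x)"
      using A.l_inv[of \<phi>] \<phi> \<psi> by (simp add: \<psi>_def[symmetric] AutoGroup_simps)
    then have "\<psi> ` (\<phi> ` Dset) = (\<lambda>x\<in>carrier (Vgrp m n). x) ` Dset"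
      using compose_img[of \<psi> \<phi>] by simp
    also have "\<dots> = Dset" using D by (auto simp: subset_iff)
    finally have "\<psi> s <#\<^bsub>Vgrp m n\<^esub> (\<psi> ` Dset) = Dset"
      using \<phi> \<psi> D by (simp add: coset)
    then have "inv\<^bsub>Vgrp m n\<^esub> \<psi> s <#\<^bsub>Vgrp m n\<^esub> (\<psi> s <#\<^bsub>Vgrp m n\<^esub> (\<psi> ` Dset))
        = inv\<^bsub>Vgrp m n\<^esub> \<psi> s <#\<^bsub>Vgrp m n\<^esub> Dset"
      by simp
    then have "\<psi> ` Dset = inv\<^bsub>Vgrp m n\<^esub> \<psi> s <#\<^bsub>Vgrp m n\<^esub> Dset"
      using img[OF \<psi> D] autoD(4)[OF \<psi> \<phi>(2)] by (simp add: V.lcos_m_assoc V.lcos_mult_one)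
    then show "inv\<^bsub>AutoGroup (Vgrp m n)\<^esub> \<phi> \<in> Kset m n"
      using \<psi> autoD(4)[OF \<psi> \<phi>(2)] unfolding \<psi>_def[symmetric]
      by (auto simp: Kset_def intro!: bexI[of _ "inv\<^bsub>Vgrp m n\<^esub> \<psi> s"])
  qed
qed

lemma group_Kgrp: "\<lbrakk>m \<ge> 2; n \<ge> 2\<rbrakk> \<Longrightarrow> group (Kgrp m n)"
  unfolding Kgrp_def
  by (intro subgroup.subgroup_is_group subgroup_Kset group.AutoGroup group_Vgrp)

lemma group_Ggrp:
  assumes "m \<ge> 2" "n \<ge> 2"
  shows "group (Ggrp m n)"
  unfolding Ggrp_def
proof (intro group_semidirect_prod group_Vgrp group_Kgrp assms)
  show "(\<lambda>\<phi>. \<phi>) \<in> hom (Kgrp m n) (AutoGroup (Vgrp m n))"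
    by (auto simp: Kgrp_def hom_def Kset_def AutoGroup_simps)
qed

lemma point_act_Bij:
  assumes "g \<in> carrier (Ggrp m n)"
  shows "bij_betw (point_act m n g) (carrier (Vgrp m n)) (carrier (Vgrp m n))"
proof -
  interpret V: group "Vgrp m n" by (rule group_Vgrp)
  obtain u \<phi> where g: "g = (u, \<phi>)" "u \<in> carrier (Vgrp m n)" "\<phi> \<in> auto (Vgrp m n)"
    using assms by (auto simp: Ggrp_def semidirect_prod_def Kgrp_def Kset_def)
  have "bij_betw (\<lambda>v. u \<otimes>\<^bsub>Vgrp m n\<^esub> v) (carrier (Vgrp m n)) (carrier (Vgrp m n))"
    using g V.inj_on_cmult V.surj_const_mult by (simp add: bij_betw_def)
  with autoD(2)[OF g(3)]
  have "bij_betw ((\<lambda>v. u \<otimes>\<^bsub>Vgrp m n\<^esub> v) \<circ> \<phi>) (carrier (Vgrp m n)) (carrier (Vgrp m n))"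
    by (rule bij_betw_trans)
  then show ?thesis
    by (rule bij_betw_cong[THEN iffD1, rotated]) (simp add: g point_act_def)
qed

lemma point_act_mult:
  assumes "g \<in> carrier (Ggrp m n)" "h \<in> carrier (Ggrp m n)" "v \<in> carrier (Vgrp m n)"
  shows "point_act m n (g \<otimes>\<^bsub>Ggrp m n\<^esub> h) v = point_act m n g (point_act m n h v)"
proof -
  interpret V: group "Vgrp m n" by (rule group_Vgrp)
  obtain u \<phi> w \<psi> where g: "g = (u, \<phi>)" "u \<in> carrier (Vgrp m n)" "\<phi> \<in> auto (Vgrp m n)"
    and h: "h = (w, \<psi>)" "w \<in> carrier (Vgrp m n)" "\<psi> \<in> auto (Vgrp m n)"
    using assms by (auto simp: Ggrp_def semidirect_prod_def Kgrp_def Kset_def)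
  have "g \<otimes>\<^bsub>Ggrp m n\<^esub> h = (u \<otimes>\<^bsub>Vgrp m n\<^esub> \<phi> w, compose (carrier (Vgrp m n)) \<phi> \<psi>)"
    using g h by (simp add: Ggrp_def semidirect_prod_def Kgrp_def AutoGroup_simps)
  then show ?thesis
    using g h assms(3)
    by (simp add: point_act_def compose_eq V.m_assoc autoD(4,5))
qed

lemma group_action_subset_act:
  assumes "m \<ge> 2" "n \<ge> 2"
  shows "group_action (Ggrp m n) (Pow (carrier (Vgrp m n))) (subset_act m n)"
proof -
  let ?P = "Pow (carrier (Vgrp m n))"
  interpret G: group "Ggrp m n" by (rule group_Ggrp[OF assms])
  have bij: "subset_act m n g \<in> Bij ?P" if "g \<in> carrier (Ggrp m n)" for g
  proof -
    have "bij_betw ((`) (point_act m n g)) ?P ?P"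
      by (rule bij_betw_Pow[OF point_act_Bij[OF that]])
    then have "bij_betw (subset_act m n g) ?P ?P"
      by (rule bij_betw_cong[THEN iffD1, rotated]) (simp add: subset_act_def)
    then show ?thesis by (simp add: Bij_def subset_act_def)
  qed
  have mult: "subset_act m n (g \<otimes>\<^bsub>Ggrp m n\<^esub> h) = compose ?P (subset_act m n g) (subset_act m n h)"
    if gh: "g \<in> carrier (Ggrp m n)" "h \<in> carrier (Ggrp m n)" for g h
  proof (rule extensionalityI[of _ ?P])
    fix S assume S: "S \<in> ?P"
    have "point_act m n h ` S \<in> ?P"
      using S point_act_Bij[OF gh(2)] by (auto simp: bij_betw_def)
    moreover have "point_act m n (g \<otimes>\<^bsub>Ggrp m n\<^esub> h) ` S = point_act m n g ` point_act m n h ` S"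
      unfolding image_image using S by (intro image_cong refl point_act_mult gh) auto
    ultimately show "subset_act m n (g \<otimes>\<^bsub>Ggrp m n\<^esub> h) S
        = compose ?P (subset_act m n g) (subset_act m n h) S"
      using S by (simp add: subset_act_def compose_eq)
  qed (simp_all add: subset_act_def)
  have "subset_act m n \<in> hom (Ggrp m n) (BijGroup ?P)"
    by (rule homI) (simp_all add: BijGroup_def bij mult)
  then show ?thesis
    by (intro group_action.intro group_hom.intro group_hom_axioms.intro
        group_Ggrp[OF assms] group_BijGroup)
qed

lemma partition_subset_orbits:
  assumes "m \<ge> 2" "n \<ge> 2"
  shows "partition (Pow (carrier (Vgrp m n))) (subset_orbits m n)"
  unfolding subset_orbits_def
  by (rule group_action.orbit_partition[OF group_action_subset_act[OF assms]])

end

theory Submission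
  imports Defs
begin

text \<open>
  A translation preserves the matrix \<open>A\<close>, but an automorphism \<open>\<phi>\<close> with \<open>\<phi>(D) = t + D\<close> does so only
  up to a shift: \<open>v - u \<in> D\<close> holds iff \<open>\<phi>(v) - \<phi>(u) \<in> t + D\<close>. The shift can be absorbed by letting
  rows and columns move by different elements of \<open>G\<close>. If the rows move by \<open>g = (w, \<phi>)\<close> and the
  columns by \<open>h = (w - t, \<phi>)\<close>, then \<open>A(g u, h v) = A(u, v)\<close>
  (\<open>Amat_column_correction\<close>). Permanents do not see a relabelling of rows and columns
  (\<open>per_submatrix_reindex\<close>), so \<open>T(g U, h V) = T(U, V)\<close> (\<open>Tmat_column_correction\<close>).

  This suffices for property C. If \<open>U\<^sub>2 = g U\<^sub>1\<close>, then \<open>V \<mapsto> h V\<close> permutes every orbit, because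
  \<open>h\<close> is itself an element of \<open>G\<close>; so it matches the terms of the sum for \<open>U\<^sub>1\<close> with
  those of the sum for \<open>U\<^sub>2\<close> (\<open>property_C_if_twisted_invariant\<close>).
\<close>

lemma (in group_action) bij_betw_orbit:
  assumes g: "g \<in> carrier G" and O: "O' \<in> orbits G E \<phi>"
  shows "bij_betw (\<phi> g) O' O'"
proof -
  interpret group G
    using group_hom group_hom.axioms(1) by auto
  obtain x where x: "x \<in> E" "O' = orbit G \<phi> x"
    using O by (auto simp: orbits_def)
  have sub: "O' \<subseteq> E"
    using x element_image by (auto simp: orbit_def)
  have closed: "\<phi> k y \<in> O'" if "k \<in> carrier G" "y \<in> O'" for k y
  proof -
    obtain l where l: "l \<in> carrier G" "y = \<phi> l x"
      using \<open>y \<in> O'\<close> x by (auto simp: orbit_def)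
    then have "\<phi> k y = \<phi> (k \<otimes> l) x"
      using composition_rule[OF x(1) that(1) l(1)] by simp
    then show ?thesis
      using x l that(1) by (auto simp: orbit_def)
  qed
  have "inj_on (\<phi> g) O'"
    using inj_prop[OF g] sub by (rule inj_on_subset)
  moreover have "y \<in> \<phi> g ` O'" if "y \<in> O'" for y
  proof
    show "\<phi> (inv g) y \<in> O'" using g that by (intro closed) simp_all
    show "y = \<phi> g (\<phi> (inv g) y)"
      using orbit_sym_aux[of "inv g" y] that sub g by auto
  qed
  ultimately show ?thesis
    using closed[OF g] by (auto simp: bij_betw_def)
qed

text \<open>Invariance of \<open>T\<close> under the diagonal action would be the case \<open>h = g\<close>. It is enough that each
  \<open>g\<close> acting on the first argument can be compensated by some \<open>h\<close> acting on the second, as a sum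
  over an orbit is unchanged when its summation variable is moved by \<open>h\<close>.\<close>

lemma (in group_action) property_C_if_twisted_invariant:
  fixes T :: "'c \<Rightarrow> 'c \<Rightarrow> 'd::comm_monoid_add"
  assumes "\<And>g. g \<in> carrier G \<Longrightarrow>
    \<exists>h\<in>carrier G. \<forall>U\<in>E. \<forall>V\<in>E. T (\<phi> g U) (\<phi> h V) = T U V"
  shows "property_C T (orbits G E \<phi>)"
  unfolding property_C_def
proof (intro ballI)
  fix O1 O2 U1 U2
  assume O1: "O1 \<in> orbits G E \<phi>" and O2: "O2 \<in> orbits G E \<phi>" and U: "U1 \<in> O1" "U2 \<in> O1"
  have sub: "O' \<subseteq> E" if "O' \<in> orbits G E \<phi>" for O'
    using that element_image by (auto simp: orbits_def orbit_def)
  have U1E: "U1 \<in> E" using sub[OF O1] U by blast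
  have "O1 = orbit G \<phi> U1"
  proof -
    obtain x where x: "x \<in> E" "O1 = orbit G \<phi> x" using O1 by (auto simp: orbits_def)
    have "U1 \<in> orbit G \<phi> U1" by (rule orbit_refl[OF U1E])
    moreover have "orbit G \<phi> U1 \<in> orbits G E \<phi>" using U1E by (auto simp: orbits_def)
    ultimately show ?thesis using disjoint_union[OF _ O1] U by blast
  qed
  then obtain g where g: "g \<in> carrier G" "U2 = \<phi> g U1"
    using U by (auto simp: orbit_def)
  obtain h where h: "h \<in> carrier G" "\<And>U V. \<lbrakk>U \<in> E; V \<in> E\<rbrakk> \<Longrightarrow> T (\<phi> g U) (\<phi> h V) = T U V"
    using assms[OF g(1)] by blast
  have "(\<Sum>V\<in>O2. T U2 V) = (\<Sum>V\<in>O2. T U2 (\<phi> h V))"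
    by (rule sum.reindex_bij_betw[OF bij_betw_orbit[OF h(1) O2], symmetric])
  also have "\<dots> = (\<Sum>V\<in>O2. T U1 V)"
    using h(2) U1E sub[OF O2] by (intro sum.cong) (auto simp: g)
  finally show "(\<Sum>V\<in>O2. T U1 V) = (\<Sum>V\<in>O2. T U2 V)" ..
qed

lemma per_submatrix_reindex:
  assumes f: "bij_betw f R R'" and h: "bij_betw h C C'"
    and AB: "\<And>u v. \<lbrakk>u \<in> R; v \<in> C\<rbrakk> \<Longrightarrow> B (f u) (h v) = A u v"
  shows "per_submatrix B R' C' = per_submatrix A R C"
proof -
  let ?f' = "inv_into R f" and ?h' = "inv_into C h"
  have f': "bij_betw ?f' R' R" and h': "bij_betw ?h' C' C"
    using f h by (auto intro: bij_betw_inv_into)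
  note [simp] = bij_betw_inv_into_left[OF f] bij_betw_inv_into_right[OF f]
    bij_betw_inv_into_left[OF h] bij_betw_inv_into_right[OF h]
    bij_betwE[OF f, rule_format] bij_betwE[OF h, rule_format]
    bij_betwE[OF f', rule_format] bij_betwE[OF h', rule_format]
  \<comment> \<open>Restricting the conjugated bijections keeps them extensional, so conjugation by \<open>f\<close> and \<open>h\<close>
    is a bijection between the two index sets of the sums.\<close>
  show ?thesis
    unfolding per_submatrix_def
  proof (rule sum.reindex_bij_witness[where
        i = "\<lambda>\<sigma>. restrict (h \<circ> \<sigma> \<circ> ?f') R'" and j = "\<lambda>\<tau>. restrict (?h' \<circ> \<tau> \<circ> f) R"])
    fix \<tau> assume "\<tau> \<in> {\<tau>. \<tau> \<in> R' \<rightarrow>\<^sub>E C' \<and> bij_betw \<tau> R' C'}"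
    then have \<tau>: "\<tau> \<in> R' \<rightarrow>\<^sub>E C'" "bij_betw \<tau> R' C'" by auto
    note [simp] = bij_betwE[OF \<tau>(2), rule_format]
    show "restrict (h \<circ> restrict (?h' \<circ> \<tau> \<circ> f) R \<circ> ?f') R' = \<tau>"
      using \<tau>(1) by (intro extensionalityI[of _ R']) (auto simp: PiE_def)
    have "bij_betw (?h' \<circ> \<tau> \<circ> f) R C"
      by (intro bij_betw_trans[OF f] bij_betw_trans[OF \<tau>(2)] h')
    then show "restrict (?h' \<circ> \<tau> \<circ> f) R \<in> {\<sigma>. \<sigma> \<in> R \<rightarrow>\<^sub>E C \<and> bij_betw \<sigma> R C}"
      by (auto cong: bij_betw_cong)
    have "(\<Prod>u\<in>R. A u (restrict (?h' \<circ> \<tau> \<circ> f) R u)) = (\<Prod>u\<in>R. B (f u) (\<tau> (f u)))"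
      by (intro prod.cong) (auto simp flip: AB)
    also have "\<dots> = (\<Prod>u\<in>R'. B u (\<tau> u))"
      by (rule prod.reindex_bij_betw[OF f])
    finally show "(\<Prod>u\<in>R. A u (restrict (?h' \<circ> \<tau> \<circ> f) R u)) = (\<Prod>u\<in>R'. B u (\<tau> u))" .
  next
    fix \<sigma> assume "\<sigma> \<in> {\<sigma>. \<sigma> \<in> R \<rightarrow>\<^sub>E C \<and> bij_betw \<sigma> R C}"
    then have \<sigma>: "\<sigma> \<in> R \<rightarrow>\<^sub>E C" "bij_betw \<sigma> R C" by auto
    note [simp] = bij_betwE[OF \<sigma>(2), rule_format]
    show "restrict (?h' \<circ> restrict (h \<circ> \<sigma> \<circ> ?f') R' \<circ> f) R = \<sigma>"
      using \<sigma>(1) by (intro extensionalityI[of _ R]) (auto simp: PiE_def)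
    have "bij_betw (h \<circ> \<sigma> \<circ> ?f') R' C'"
      by (intro bij_betw_trans[OF f'] bij_betw_trans[OF \<sigma>(2)] h)
    then show "restrict (h \<circ> \<sigma> \<circ> ?f') R' \<in> {\<tau>. \<tau> \<in> R' \<rightarrow>\<^sub>E C' \<and> bij_betw \<tau> R' C'}"
      by (auto cong: bij_betw_cong)
  qed
qed

lemma comm_group_Vgrp: "comm_group (Vgrp m n)"
proof (rule group.group_comm_groupI[OF group_Vgrp])
  show "x \<otimes>\<^bsub>Vgrp m n\<^esub> y = y \<otimes>\<^bsub>Vgrp m n\<^esub> x" for x y
    by (cases x; cases y) (simp add: Vgrp_def integer_mod_group_def add.commute)
qed

lemma (in comm_group) mult_inv_mult_cancel:
  assumes "s \<in> carrier G" "w \<in> carrier G" "x \<in> carrier G" "y \<in> carrier G"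
  shows "(s \<otimes> w \<otimes> x) \<otimes> inv (w \<otimes> y) = s \<otimes> (x \<otimes> inv y)"
proof -
  have "(s \<otimes> w \<otimes> x) \<otimes> (w' \<otimes> y') = s \<otimes> (x \<otimes> y') \<otimes> (w \<otimes> w')"
    if "w' \<in> carrier G" "y' \<in> carrier G" for w' y'
    using assms that by (simp add: m_ac)
  from this[of "inv w" "inv y"] show ?thesis
    using assms by (simp add: inv_mult)
qed

text \<open>The translation parts of \<open>g\<close> and \<open>h\<close> differ by \<open>t\<close> so that \<open>h v - g u = \<phi>(v - u) - t\<close>,
  and \<open>\<phi>(D) - t = D\<close>.\<close>

lemma Amat_column_correction:
  assumes "m \<ge> 2" "n \<ge> 2" and g: "g \<in> carrier (Ggrp m n)"
  obtains h where "h \<in> carrier (Ggrp m n)"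
    "\<And>u v. \<lbrakk>u \<in> carrier (Vgrp m n); v \<in> carrier (Vgrp m n)\<rbrakk>
      \<Longrightarrow> Amat m n (point_act m n g u) (point_act m n h v) = Amat m n u v"
proof -
  interpret V: comm_group "Vgrp m n" by (rule comm_group_Vgrp)
  note D = Dset_subset[OF assms(1,2)]
  obtain w \<phi> where w: "g = (w, \<phi>)" "w \<in> carrier (Vgrp m n)" and K: "\<phi> \<in> Kset m n"
    using g by (auto simp: Ggrp_def semidirect_prod_def Kgrp_def)
  then obtain t where \<phi>: "\<phi> \<in> auto (Vgrp m n)"
    and t: "t \<in> carrier (Vgrp m n)" "\<phi> ` Dset = t <#\<^bsub>Vgrp m n\<^esub> Dset"
    by (auto simp: Kset_def)
  define s where "s = inv\<^bsub>Vgrp m n\<^esub> t"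
  have s: "s \<in> carrier (Vgrp m n)" using t by (simp add: s_def)
  interpret \<phi>: group_hom "Vgrp m n" "Vgrp m n" \<phi>
    using autoD(1)[OF \<phi>] by unfold_locales
  have "s <#\<^bsub>Vgrp m n\<^esub> (\<phi> ` Dset) = Dset"
    using t D by (simp add: s_def V.lcos_m_assoc V.lcos_mult_one)
  then have sD: "(\<lambda>x. s \<otimes>\<^bsub>Vgrp m n\<^esub> \<phi> x) ` Dset = Dset"
    by (auto simp: l_coset_def)
  have inj: "inj_on (\<lambda>x. s \<otimes>\<^bsub>Vgrp m n\<^esub> \<phi> x) (carrier (Vgrp m n))"
    using autoD(2)[OF \<phi>] s by (auto simp: inj_on_def bij_betw_def)
  have mem: "s \<otimes>\<^bsub>Vgrp m n\<^esub> \<phi> x \<in> Dset \<longleftrightarrow> x \<in> Dset" if "x \<in> carrier (Vgrp m n)" for x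
    using inj_on_image_mem_iff[OF inj that D] sD by simp
  show thesis
  proof (rule that)
    show "(s \<otimes>\<^bsub>Vgrp m n\<^esub> w, \<phi>) \<in> carrier (Ggrp m n)"
      using s w K by (simp add: Ggrp_def semidirect_prod_def Kgrp_def)
    fix u v assume uv: "u \<in> carrier (Vgrp m n)" "v \<in> carrier (Vgrp m n)"
    have "(s \<otimes>\<^bsub>Vgrp m n\<^esub> w \<otimes>\<^bsub>Vgrp m n\<^esub> \<phi> v) \<otimes>\<^bsub>Vgrp m n\<^esub> inv\<^bsub>Vgrp m n\<^esub> (w \<otimes>\<^bsub>Vgrp m n\<^esub> \<phi> u)
        = s \<otimes>\<^bsub>Vgrp m n\<^esub> \<phi> (v \<otimes>\<^bsub>Vgrp m n\<^esub> inv\<^bsub>Vgrp m n\<^esub> u)"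
      using s w uv by (simp add: V.mult_inv_mult_cancel)
    then show "Amat m n (point_act m n g u) (point_act m n (s \<otimes>\<^bsub>Vgrp m n\<^esub> w, \<phi>) v) = Amat m n u v"
      using uv mem[of "v \<otimes>\<^bsub>Vgrp m n\<^esub> inv\<^bsub>Vgrp m n\<^esub> u"]
      by (simp add: Amat_def point_act_def w)
  qed
qed

text \<open>Both \<open>g\<close> and \<open>h\<close> permute the points, so cardinalities are kept and \<open>h\<close> commutes with
  complements.\<close>

lemma Tmat_column_correction:
  assumes "m \<ge> 2" "n \<ge> 2" and g: "g \<in> carrier (Ggrp m n)"
  shows "\<exists>h\<in>carrier (Ggrp m n). \<forall>U\<in>Pow (carrier (Vgrp m n)). \<forall>V\<in>Pow (carrier (Vgrp m n)).
    Tmat m n (subset_act m n g U) (subset_act m n h V) = Tmat m n U V"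
proof -
  obtain h where h: "h \<in> carrier (Ggrp m n)"
    and A: "\<And>u v. \<lbrakk>u \<in> carrier (Vgrp m n); v \<in> carrier (Vgrp m n)\<rbrakk>
      \<Longrightarrow> Amat m n (point_act m n g u) (point_act m n h v) = Amat m n u v"
    using Amat_column_correction[OF assms] by blast
  note bij = point_act_Bij[OF g] point_act_Bij[OF h]
  have "Tmat m n (subset_act m n g U) (subset_act m n h V) = Tmat m n U V"
    if U: "U \<subseteq> carrier (Vgrp m n)" and V: "V \<subseteq> carrier (Vgrp m n)" for U V
  proof -
    let ?g = "point_act m n g" and ?h = "point_act m n h" and ?X = "carrier (Vgrp m n)"
    have inj: "inj_on ?g U" "inj_on ?h V"
      using bij U V by (auto simp: bij_betw_def intro: inj_on_subset)
    have "bij_betw ?g U (?g ` U)"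
      using inj by (simp add: bij_betw_def)
    moreover have "bij_betw ?h (?X - V) (?X - ?h ` V)"
      using bij(2) V inj_on_image_set_diff[of ?h ?X ?X V]
      by (auto simp: bij_betw_def intro: inj_on_subset)
    ultimately have "per_submatrix (Amat m n) (?g ` U) (?X - ?h ` V)
        = per_submatrix (Amat m n) U (?X - V)"
      by (rule per_submatrix_reindex) (use A U in auto)
    then show ?thesis
      using U V by (simp add: Tmat_def subset_act_def card_image inj)
  qed
  with h show ?thesis by blast
qed

theorem proposition3p1:
  fixes m n :: nat
  assumes "m \<ge> 2" and "n \<ge> 2"
  shows "property_C (Tmat m n) (subset_orbits m n)"
  unfolding subset_orbits_def
  by (rule group_action.property_C_if_twisted_invariant[OF group_action_subset_act[OF assms]])
    (rule Tmat_column_correction[OF assms])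

end
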